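(* Let $\{f_n\}_{n\ge 1}$ be any sequence in $\mathrm{Hol}(\mathbb{D},\mathbb{D})$ and let $L_n=f_n\circ f_{n-1}\circ\dots\circ f_1$. Then there is a map $h\in\mathrm{Hol}(\mathbb{D},\mathbb{D})$, unique up to left composition by elements of $\mathrm{Aut}(\mathbb{D})$, such that $L_n^\#\to h^\#$ uniformly on compact subsets of $\mathbb{D}$.
   Context: $\mathbb{D}$ is the open unit disc; $\mathrm{Hol}(\mathbb{D},\mathbb{D})$ is the set of holomorphic self-maps of $\mathbb{D}$ (constants included) and $\mathrm{Aut}(\mathbb{D})$ the group of conformal automorphisms of $\mathbb{D}$. For $f\in\mathrm{Hol}(\mathbb{D},\mathbb{D})$ the hyperbolic distortion is $f^\#(z)=\lim_{w\to z}\omega(f(z),f(w))/\omega(z,w)$, where $\omega$ is the hyperbolic distance on $\mathbb{D}$; equivalently $f^\#(z)=|f'(z)|\frac{1-|z|^2}{1-|f(z)|^2}$. "Unique up to left composition by elements of $\mathrm{Aut}(\mathbb{D})$" means that any two maps $h,k$ with the stated property satisfy $k=\phi\circ h$ for some $\phi\in\mathrm{Aut}(\mathbb{D})$. *)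

theory Defs
  imports "HOL-Complex_Analysis.Complex_Analysis"
begin

definition hol_self_maps :: "(complex \<Rightarrow> complex) set" where
  "hol_self_maps = {f. f holomorphic_on ball 0 1 \<and> f ` ball 0 1 \<subseteq> ball 0 1}"

definition disc_automorphisms :: "(complex \<Rightarrow> complex) set" where
  "disc_automorphisms = {\<phi>. \<phi> holomorphic_on ball 0 1 \<and> bij_betw \<phi> (ball 0 1) (ball 0 1)}"

text \<open>
  The distance induced by the metric \<open>2 |dz| / (1 - |z|\<^sup>2)\<close> of curvature \<open>-1\<close>.
  The factor \<open>2\<close> is immaterial for the hyperbolic distortion.
\<close>

definition hyperbolic_dist :: "complex \<Rightarrow> complex \<Rightarrow> real" where
  "hyperbolic_dist z w = 2 * artanh (cmod (Moebius_function 0 w z))"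

definition hyperbolic_distortion :: "(complex \<Rightarrow> complex) \<Rightarrow> complex \<Rightarrow> real" where
  "hyperbolic_distortion f z =
     Lim (at z) (\<lambda>w. hyperbolic_dist (f z) (f w) / hyperbolic_dist z w)"

text \<open>For holomorphic self-maps of the disc the limit exists and has the familiar closed form.\<close>

lemma tendsto_hyperbolic_distortion:
  assumes f: "f \<in> hol_self_maps" and z: "z \<in> ball 0 1"
  shows "((\<lambda>w. hyperbolic_dist (f z) (f w) / hyperbolic_dist z w) \<longlongrightarrow>
           cmod (deriv f z) * ((1 - (cmod z)\<^sup>2) / (1 - (cmod (f z))\<^sup>2))) (at z)"
proof -
  define g :: "real \<Rightarrow> real" where "g = (\<lambda>t. if t = 0 then 1 else artanh t / t)"
  have "(artanh has_field_derivative 1) (at (0::real))"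
    using artanh_real_has_field_derivative[of 0 UNIV] by simp
  then have "(\<lambda>t. artanh t / t) \<midarrow>0\<rightarrow> (1::real)"
    by (simp add: has_field_derivative_iff)
  then have "g \<midarrow>0\<rightarrow> 1"
    by (rule tendsto_cong[THEN iffD1, rotated])
       (auto simp: g_def eventually_at_filter)
  then have g0: "isCont g 0"
    by (simp add: isCont_def g_def)
  have art: "artanh t = t * g t" for t
    by (simp add: g_def)
  define p where "p = (\<lambda>z w. cmod (z - w) / cmod (1 - cnj w * z))"
  have hd: "hyperbolic_dist a b = 2 * (p a b * g (p a b))" for a b
    by (simp add: hyperbolic_dist_def art p_def Moebius_function_simple norm_divide)
  have den: "1 - cnj a * a = of_real (1 - (cmod a)\<^sup>2)" for a
    by (simp only: of_real_diff of_real_1 complex_norm_square mult.commute)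
  have nz: "cmod (1 - cnj a * a) = 1 - (cmod a)\<^sup>2" "1 - (cmod a)\<^sup>2 > 0"
    if "a \<in> ball 0 1" for a
  proof -
    show "1 - (cmod a)\<^sup>2 > 0" using that by (simp add: abs_square_less_1)
    then show "cmod (1 - cnj a * a) = 1 - (cmod a)\<^sup>2" unfolding den norm_of_real by simp
  qed
  have fz: "f z \<in> ball 0 1" using f z unfolding hol_self_maps_def by blast
  have D: "(f has_field_derivative deriv f z) (at z)"
    using f z by (auto simp: hol_self_maps_def intro: holomorphic_derivI)
  then have cf: "f \<midarrow>z\<rightarrow> f z"
    using DERIV_isCont isCont_def by blast
  have dq: "((\<lambda>w. (f w - f z) / (w - z)) \<longlongrightarrow> deriv f z) (at z)"
    using D by (simp add: has_field_derivative_iff)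
  have pz: "((\<lambda>w. p z w) \<longlongrightarrow> 0) (at z)" and pfz: "((\<lambda>w. p (f z) (f w)) \<longlongrightarrow> 0) (at z)"
    unfolding p_def using nz[OF z] nz[OF fz]
    by (auto intro!: tendsto_eq_intros cf)
  have gz: "((\<lambda>w. g (p z w)) \<longlongrightarrow> 1) (at z)" "((\<lambda>w. g (p (f z) (f w))) \<longlongrightarrow> 1) (at z)"
    using isCont_tendsto_compose[OF g0 pz] isCont_tendsto_compose[OF g0 pfz]
    by (simp_all add: g_def)
  have "((\<lambda>w. cmod ((f w - f z) / (w - z)) *
            (cmod (1 - cnj w * z) / cmod (1 - cnj (f w) * f z)) *
            (g (p (f z) (f w)) / g (p z w))) \<longlongrightarrow>
          cmod (deriv f z) * (cmod (1 - cnj z * z) / cmod (1 - cnj (f z) * f z)) * (1 / 1)) (at z)"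
    using nz[OF fz] by (intro tendsto_intros dq gz cf) auto
  also have "(\<lambda>w. cmod ((f w - f z) / (w - z)) *
            (cmod (1 - cnj w * z) / cmod (1 - cnj (f w) * f z)) *
            (g (p (f z) (f w)) / g (p z w))) =
      (\<lambda>w. hyperbolic_dist (f z) (f w) / hyperbolic_dist z w)"
    by (rule ext) (simp add: hd p_def norm_divide norm_minus_commute mult_ac)
  finally show ?thesis
    using nz[OF z] nz[OF fz] by simp
qed

corollary hyperbolic_distortion_eq:
  assumes "f \<in> hol_self_maps" and "z \<in> ball 0 1"
  shows "hyperbolic_distortion f z =
           cmod (deriv f z) * ((1 - (cmod z)\<^sup>2) / (1 - (cmod (f z))\<^sup>2))"
  unfolding hyperbolic_distortion_def
  by (rule tendsto_Lim[OF trivial_limit_at tendsto_hyperbolic_distortion[OF assms]])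

text \<open>\<open>left_comp f n\<close> is \<open>f n \<circ> \<dots> \<circ> f 1\<close>; the value \<open>f 0\<close> is not used.\<close>

primrec left_comp :: "(nat \<Rightarrow> complex \<Rightarrow> complex) \<Rightarrow> nat \<Rightarrow> complex \<Rightarrow> complex" where
  "left_comp f 0 = id"
| "left_comp f (Suc n) = f (Suc n) \<circ> left_comp f n"

definition distortions_converge_to ::
    "(nat \<Rightarrow> complex \<Rightarrow> complex) \<Rightarrow> (complex \<Rightarrow> complex) \<Rightarrow> bool" where
  "distortions_converge_to L h \<longleftrightarrow>
     (\<forall>K. compact K \<and> K \<subseteq> ball 0 1 \<longrightarrow>
        uniform_limit K (\<lambda>n. hyperbolic_distortion (L n)) (hyperbolic_distortion h) sequentially)"

end

theory Submission
  imports Defs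
begin

text \<open>
  Existence is a monotone normal-family argument. By the chain rule
  (\<open>hyperbolic_distortion_comp\<close>) the distortion is multiplicative, and by
  \<open>Schwarz_Pick\<close> each new factor of a left composition has distortion at most one; hence
  the distortions of \<open>L\<^sub>n\<close> decrease pointwise. The maps \<open>L\<^sub>n\<close> themselves need not converge,
  but automorphisms have distortion one, so each \<open>L\<^sub>n\<close> may be followed by an automorphism that
  brings \<open>L\<^sub>n 0\<close> back to \<open>0\<close>. Montel's theorem then supplies a subsequential limit \<open>h\<close>, which
  cannot escape to the unit circle because \<open>h 0 = 0\<close>
  (\<open>normalized_sequence_has_limit\<close>). Monotonicity turns convergence of the distortions along a
  subsequence into convergence of the whole sequence, and Dini's theorem
  (\<open>Dini_antimono\<close>) makes it uniform on compact sets.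

  Uniqueness says that two maps \<open>h\<close>, \<open>k\<close> with the same distortion differ by an automorphism. If
  the common distortion vanishes identically, both are constant. Otherwise there is a point \<open>a\<close> at
  which neither derivative vanishes, and automorphisms applied on the left achieve
  \<open>h a = k a = 0\<close> and \<open>h' a = k' a\<close>. The claim is then \<open>h = k\<close>
  (\<open>equal_distortion_rigid\<close>). Equality of distortions reads
  \<open>|k'| - |h'| = |h|\<^sup>2 |k'| - |k|\<^sup>2 |h'|\<close>. If \<open>d = k - h\<close> had a zero of finite order \<open>m + 1\<close> at
  \<open>a\<close>, the right-hand side would be \<open>o(|z - a|\<^sup>m)\<close>, while along a suitable ray the left-hand side
  grows like a positive multiple of \<open>|z - a|\<^sup>m\<close>: a contradiction.
\<close>

section \<open>The distortion is multiplicative and at most one\<close>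

lemma hol_self_mapsD:
  assumes "f \<in> hol_self_maps"
  shows "f holomorphic_on ball 0 1" and "z \<in> ball 0 1 \<Longrightarrow> f z \<in> ball 0 1"
  using assms by (simp_all add: hol_self_maps_def image_subset_iff)

lemma hol_self_maps_comp:
  assumes "f \<in> hol_self_maps" and "g \<in> hol_self_maps"
  shows "g \<circ> f \<in> hol_self_maps"
proof -
  have "g \<circ> f holomorphic_on ball 0 1"
    by (rule holomorphic_on_compose_gen[where t = "ball 0 1"])
       (use assms in \<open>auto simp: hol_self_maps_def\<close>)
  then show ?thesis
    using assms by (fastforce simp: hol_self_maps_def)
qed

lemma one_minus_cmod_square_pos:
  assumes "z \<in> ball (0::complex) 1"
  shows "0 < 1 - (cmod z)\<^sup>2"
  using assms by (simp add: abs_square_less_1)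

lemma hyperbolic_distortion_nonneg:
  assumes "f \<in> hol_self_maps" and "z \<in> ball 0 1"
  shows "0 \<le> hyperbolic_distortion f z"
  using one_minus_cmod_square_pos[OF assms(2)]
    one_minus_cmod_square_pos[OF hol_self_mapsD(2)[OF assms]]
  by (simp add: hyperbolic_distortion_eq[OF assms])

lemma hyperbolic_distortion_eq_0_iff:
  assumes "f \<in> hol_self_maps" and "z \<in> ball 0 1"
  shows "hyperbolic_distortion f z = 0 \<longleftrightarrow> deriv f z = 0"
  using one_minus_cmod_square_pos[OF assms(2)]
    one_minus_cmod_square_pos[OF hol_self_mapsD(2)[OF assms]]
  by (simp add: hyperbolic_distortion_eq[OF assms])

lemma hyperbolic_distortion_comp:
  assumes f: "f \<in> hol_self_maps" and g: "g \<in> hol_self_maps" and z: "z \<in> ball 0 1"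
  shows "hyperbolic_distortion (g \<circ> f) z = hyperbolic_distortion g (f z) * hyperbolic_distortion f z"
proof -
  note fz = hol_self_mapsD(2)[OF f z]
  have "f field_differentiable at z" "g field_differentiable at (f z)"
    using hol_self_mapsD(1)[OF f] hol_self_mapsD(1)[OF g] z fz
    by (meson holomorphic_on_imp_differentiable_at open_ball)+
  then have "deriv (g \<circ> f) z = deriv g (f z) * deriv f z"
    by (rule deriv_chain)
  then show ?thesis
    using one_minus_cmod_square_pos[OF fz]
    by (simp add: hyperbolic_distortion_eq[OF f z] hyperbolic_distortion_eq[OF g fz]
        hyperbolic_distortion_eq[OF hol_self_maps_comp[OF f g] z] norm_mult)
qed

lemma hyperbolic_distortion_cong:
  assumes "f \<in> hol_self_maps" and "g \<in> hol_self_maps" and z: "z \<in> ball 0 1"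
    and eq: "\<And>w. w \<in> ball 0 1 \<Longrightarrow> f w = g w"
  shows "hyperbolic_distortion f z = hyperbolic_distortion g z"
proof -
  have "\<forall>\<^sub>F w in nhds z. w \<in> ball 0 1"
    using z by (intro eventually_nhds_in_open) auto
  then have "deriv f z = deriv g z"
    using eq by (intro deriv_cong_ev) (auto elim: eventually_mono)
  then show ?thesis
    using assms by (simp add: hyperbolic_distortion_eq)
qed

lemma Moebius_hol_self_map:
  assumes "w \<in> ball 0 1"
  shows "Moebius_function 0 w \<in> hol_self_maps"
  using assms Moebius_function_holomorphic Moebius_function_norm_lt_1
  by (auto simp: hol_self_maps_def)

text \<open>
  Schwarz-Pick needs the isometry property of the standard automorphisms only at the point they
  send to \<open>0\<close> and at \<open>0\<close> itself, where the derivative is immediate. The property at all other points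
  then comes out of Schwarz-Pick, in \<open>hyperbolic_distortion_automorphism\<close>.
\<close>

lemma Moebius_distortion_special:
  assumes w: "w \<in> ball 0 1"
  shows "hyperbolic_distortion (Moebius_function 0 w) w = 1"
    and "hyperbolic_distortion (Moebius_function 0 w) 0 = 1"
proof -
  have pos: "0 < 1 - (cmod w)\<^sup>2"
    by (rule one_minus_cmod_square_pos[OF w])
  have ww: "1 - cnj w * w = of_real (1 - (cmod w)\<^sup>2)"
    by (simp only: of_real_diff of_real_1 complex_norm_square mult.commute)
  then have nz: "1 - cnj w * w \<noteq> 0"
    using pos by (metis less_irrefl of_real_eq_0_iff)
  have D: "(Moebius_function 0 w has_field_derivative
      (1 - cnj w * w) / (1 - cnj w * z)\<^sup>2) (at z)" if "1 - cnj w * z \<noteq> 0" for z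
    unfolding Moebius_function_def using that
    by (auto intro!: derivative_eq_intros simp: power2_eq_square divide_simps) (simp add: algebra_simps)
  have dw: "deriv (Moebius_function 0 w) w = 1 / (1 - cnj w * w)"
    using DERIV_imp_deriv[OF D[OF nz]] nz by (simp add: power2_eq_square)
  have d0: "deriv (Moebius_function 0 w) 0 = 1 - cnj w * w"
    using DERIV_imp_deriv[OF D[of 0]] by simp
  have n: "cmod (1 - cnj w * w) = 1 - (cmod w)\<^sup>2"
    unfolding ww norm_of_real using pos by simp
  show "hyperbolic_distortion (Moebius_function 0 w) w = 1"
    using pos w n by (simp add: hyperbolic_distortion_eq[OF Moebius_hol_self_map[OF w] w] dw
        norm_divide Moebius_function_eq_zero)
  show "hyperbolic_distortion (Moebius_function 0 w) 0 = 1"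
    using pos w n by (simp add: hyperbolic_distortion_eq[OF Moebius_hol_self_map[OF w]] d0
        Moebius_function_of_zero)
qed

text \<open>
  Conjugating \<open>f\<close> by automorphisms that move \<open>z\<close> and \<open>f z\<close> to the origin leaves the distortion
  unchanged and reduces the claim to the Schwarz lemma.
\<close>

lemma Schwarz_Pick:
  assumes f: "f \<in> hol_self_maps" and z: "z \<in> ball 0 1"
  shows "hyperbolic_distortion f z \<le> 1"
proof -
  have mz: "- z \<in> ball 0 1"
    using z by simp
  note fz = hol_self_mapsD(2)[OF f z]
  define A where "A = Moebius_function 0 (- z)"
  define B where "B = Moebius_function 0 (f z)"
  have AB: "A \<in> hol_self_maps" "B \<in> hol_self_maps"
    unfolding A_def B_def using Moebius_hol_self_map mz fz by blast+
  have A0: "A 0 = z"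
    by (simp add: A_def Moebius_function_of_zero)
  note fA = hol_self_maps_comp[OF AB(1) f]
  define g where "g = B \<circ> (f \<circ> A)"
  have g: "g \<in> hol_self_maps"
    unfolding g_def by (rule hol_self_maps_comp[OF fA AB(2)])
  have g0: "g 0 = 0"
    by (simp add: g_def A0 B_def Moebius_function_eq_zero)
  have "hyperbolic_distortion g 0 = hyperbolic_distortion B (f z) *
      (hyperbolic_distortion f z * hyperbolic_distortion A 0)"
    unfolding g_def
    by (subst hyperbolic_distortion_comp[OF fA AB(2)], simp)
       (subst hyperbolic_distortion_comp[OF AB(1) f], auto simp: A0)
  then have "hyperbolic_distortion f z = hyperbolic_distortion g 0"
    using Moebius_distortion_special mz fz by (simp add: A_def B_def)
  also have "\<dots> = cmod (deriv g 0)"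
    by (simp add: hyperbolic_distortion_eq[OF g] g0)
  also have "\<dots> \<le> 1"
    by (rule Schwarz_Lemma(2)[OF hol_self_mapsD(1)[OF g] g0, of 0])
       (use hol_self_mapsD(2)[OF g] in auto)
  finally show ?thesis .
qed

section \<open>Automorphisms of the disc\<close>

lemma disc_automorphisms_subset: "disc_automorphisms \<subseteq> hol_self_maps"
  by (auto simp: disc_automorphisms_def hol_self_maps_def bij_betw_def)

lemma disc_automorphisms_comp:
  assumes "\<phi> \<in> disc_automorphisms" and "\<psi> \<in> disc_automorphisms"
  shows "\<psi> \<circ> \<phi> \<in> disc_automorphisms"
proof -
  have "\<psi> \<circ> \<phi> \<in> hol_self_maps"
    using assms disc_automorphisms_subset by (intro hol_self_maps_comp) auto
  then show ?thesis
    using assms bij_betw_trans[of \<phi> "ball 0 1" "ball 0 1" \<psi> "ball 0 1"]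
    by (simp add: disc_automorphisms_def hol_self_maps_def)
qed

lemma disc_automorphisms_inverse:
  assumes "\<phi> \<in> disc_automorphisms"
  obtains \<psi> where "\<psi> \<in> disc_automorphisms"
    and "\<And>z. z \<in> ball 0 1 \<Longrightarrow> \<psi> (\<phi> z) = z"
proof -
  have hol: "\<phi> holomorphic_on ball 0 1" and bij: "bij_betw \<phi> (ball 0 1) (ball 0 1)"
    using assms by (auto simp: disc_automorphisms_def)
  have im: "\<phi> ` ball 0 1 = ball 0 1"
    using bij by (simp add: bij_betw_def)
  obtain \<psi> where \<psi>: "\<psi> holomorphic_on \<phi> ` ball 0 1" "\<And>z. z \<in> ball 0 1 \<Longrightarrow> \<psi> (\<phi> z) = z"
    using holomorphic_has_inverse[OF hol open_ball] bij unfolding bij_betw_def by metis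
  have "inv_into (ball 0 1) \<phi> w = \<psi> w" if "w \<in> ball 0 1" for w
    using that im \<psi>(2) bij by (metis bij_betw_def image_iff inv_into_f_f)
  then have "bij_betw \<psi> (ball 0 1) (ball 0 1)"
    using bij_betw_inv_into[OF bij] bij_betw_cong by blast
  then show ?thesis
    using that \<psi> im by (auto simp: disc_automorphisms_def)
qed

lemma Moebius_disc_automorphism:
  assumes "w \<in> ball 0 1"
  shows "Moebius_function 0 w \<in> disc_automorphisms"
proof -
  have "bij_betw (Moebius_function 0 w) (ball 0 1) (ball 0 1)"
    by (rule bij_betw_byWitness[where f' = "Moebius_function 0 (- w)"])
       (use assms Moebius_function_compose Moebius_function_norm_lt_1 in auto)
  then show ?thesis
    using assms Moebius_function_holomorphic by (simp add: disc_automorphisms_def)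
qed

lemma rotation_disc_automorphism:
  assumes "cmod c = 1"
  shows "(\<lambda>z. c * z) \<in> disc_automorphisms"
proof -
  have "c \<noteq> 0"
    using assms by auto
  then have "bij_betw (\<lambda>z. c * z) (ball 0 1) (ball 0 1)"
    by (intro bij_betw_byWitness[where f' = "\<lambda>z. z / c"])
       (use assms in \<open>auto simp: norm_mult norm_divide\<close>)
  then show ?thesis
    by (auto simp: disc_automorphisms_def intro!: holomorphic_intros)
qed

text \<open>
  The distortions of an automorphism and of its inverse are both at most one, and by the chain rule
  their product is the distortion of the identity.
\<close>

lemma hyperbolic_distortion_automorphism:
  assumes \<phi>: "\<phi> \<in> disc_automorphisms" and z: "z \<in> ball 0 1"
  shows "hyperbolic_distortion \<phi> z = 1"
proof -
  obtain \<psi> where \<psi>: "\<psi> \<in> disc_automorphisms" and inv: "\<And>z. z \<in> ball 0 1 \<Longrightarrow> \<psi> (\<phi> z) = z"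
    using disc_automorphisms_inverse[OF \<phi>] by blast
  have \<phi>': "\<phi> \<in> hol_self_maps" and \<psi>': "\<psi> \<in> hol_self_maps"
    using \<phi> \<psi> disc_automorphisms_subset by auto
  note \<phi>z = hol_self_mapsD(2)[OF \<phi>' z]
  have id: "id \<in> hol_self_maps"
    by (auto simp: hol_self_maps_def)
  have "hyperbolic_distortion \<psi> (\<phi> z) * hyperbolic_distortion \<phi> z = hyperbolic_distortion (\<psi> \<circ> \<phi>) z"
    by (rule hyperbolic_distortion_comp[OF \<phi>' \<psi>' z, symmetric])
  also have "\<dots> = hyperbolic_distortion id z"
    by (rule hyperbolic_distortion_cong[OF hol_self_maps_comp[OF \<phi>' \<psi>'] id z]) (simp add: inv)
  also have "\<dots> = 1"
    using one_minus_cmod_square_pos[OF z] by (simp add: hyperbolic_distortion_eq[OF id z])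
  finally have "1 \<le> hyperbolic_distortion \<phi> z"
    using mult_right_mono[OF Schwarz_Pick[OF \<psi>' \<phi>z] hyperbolic_distortion_nonneg[OF \<phi>' z]] by simp
  then show ?thesis
    using Schwarz_Pick[OF \<phi>' z] by simp
qed

lemma hyperbolic_distortion_automorphism_comp:
  assumes \<phi>: "\<phi> \<in> disc_automorphisms" and f: "f \<in> hol_self_maps" and z: "z \<in> ball 0 1"
  shows "hyperbolic_distortion (\<phi> \<circ> f) z = hyperbolic_distortion f z"
  using \<phi> disc_automorphisms_subset
    hyperbolic_distortion_automorphism[OF \<phi> hol_self_mapsD(2)[OF f z]]
  by (subst hyperbolic_distortion_comp[OF f _ z]) auto

section \<open>Existence: normal families\<close>

text \<open>
  Dini's theorem. For each \<open>e\<close> the sets where \<open>f n < g + e\<close> are relatively open, increase with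
  \<open>n\<close>, and cover \<open>K\<close>.
\<close>

lemma Dini_antimono:
  fixes f :: "nat \<Rightarrow> 'a::t2_space \<Rightarrow> real"
  assumes K: "compact K"
    and cont: "\<And>n. continuous_on K (f n)" "continuous_on K g"
    and dec: "\<And>x m n. x \<in> K \<Longrightarrow> m \<le> n \<Longrightarrow> f n x \<le> f m x"
    and lim: "\<And>x. x \<in> K \<Longrightarrow> (\<lambda>n. f n x) \<longlonglongrightarrow> g x"
  shows "uniform_limit K f g sequentially"
proof (rule uniform_limitI)
  fix e :: real
  assume e: "e > 0"
  define U where "U = (\<lambda>n. {x \<in> K. f n x - g x < e})"
  have "\<exists>T. open T \<and> U n = K \<inter> T" for n
  proof -
    have "continuous_on K (\<lambda>x. f n x - g x)"
      using cont by (intro continuous_intros)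
    then obtain T where "open T" "T \<inter> K = (\<lambda>x. f n x - g x) -` {..<e} \<inter> K"
      unfolding continuous_on_open_invariant by (meson open_lessThan)
    then show ?thesis
      by (intro exI[of _ T]) (auto simp: U_def)
  qed
  then obtain T where T: "\<And>n. open (T n)" "\<And>n. U n = K \<inter> T n"
    by metis
  have "K \<subseteq> (\<Union>n. T n)"
  proof
    fix x assume x: "x \<in> K"
    have "\<forall>\<^sub>F n in sequentially. f n x < g x + e"
      using order_tendstoD(2)[OF lim[OF x]] e by simp
    then obtain n where "f n x < g x + e"
      unfolding eventually_sequentially by blast
    then show "x \<in> (\<Union>n. T n)"
      using T(2)[of n] x unfolding U_def by fastforce
  qed
  then obtain I where I: "finite I" "K \<subseteq> (\<Union>n\<in>I. T n)"
    by (rule compactE_image[OF K T(1)])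
  obtain N where N: "\<And>n. n \<in> I \<Longrightarrow> n \<le> N"
    using I(1) finite_nat_set_iff_bounded_le by auto
  have "dist (f n x) (g x) < e" if nx: "n \<ge> N" "x \<in> K" for n x
  proof -
    obtain m where m: "m \<in> I" "x \<in> T m"
      using subsetD[OF I(2) nx(2)] by blast
    then have "f m x - g x < e"
      using T(2)[of m] nx by (auto simp: U_def)
    moreover have "f n x \<le> f m x"
      using dec N[OF m(1)] nx by simp
    moreover have "g x \<le> f n x"
      by (rule decseq_ge[OF _ lim[OF nx(2)]]) (use dec nx(2) in \<open>auto simp: decseq_def\<close>)
    ultimately show ?thesis
      by (simp add: dist_real_def)
  qed
  then show "\<forall>\<^sub>F n in sequentially. \<forall>x\<in>K. dist (f n x) (g x) < e"
    unfolding eventually_sequentially by blast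
qed

lemma continuous_on_hyperbolic_distortion:
  assumes f: "f \<in> hol_self_maps"
  shows "continuous_on (ball 0 1) (hyperbolic_distortion f)"
proof -
  have c: "continuous_on (ball 0 1) f" "continuous_on (ball 0 1) (deriv f)"
    using hol_self_mapsD(1)[OF f] by (auto intro: holomorphic_on_imp_continuous_on holomorphic_deriv)
  have "1 - (cmod (f z))\<^sup>2 \<noteq> 0" if "z \<in> ball 0 1" for z
    using one_minus_cmod_square_pos[OF hol_self_mapsD(2)[OF f that]] by simp
  then have "continuous_on (ball 0 1)
      (\<lambda>z. cmod (deriv f z) * ((1 - (cmod z)\<^sup>2) / (1 - (cmod (f z))\<^sup>2)))"
    using c by (intro continuous_intros) auto
  then show ?thesis
    by (rule continuous_on_cong[THEN iffD1, rotated 2])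
       (simp_all add: hyperbolic_distortion_eq[OF f])
qed

lemma left_comp_hol_self_map:
  assumes "\<And>n. n \<ge> 1 \<Longrightarrow> f n \<in> hol_self_maps"
  shows "left_comp f n \<in> hol_self_maps"
proof (induction n)
  case 0
  then show ?case by (auto simp: hol_self_maps_def)
next
  case (Suc n)
  then show ?case using hol_self_maps_comp[OF Suc assms[of "Suc n"]] by (simp del: o_apply add: o_def[symmetric])
qed

lemma left_comp_distortion_antimono:
  assumes f: "\<And>n. n \<ge> 1 \<Longrightarrow> f n \<in> hol_self_maps" and z: "z \<in> ball 0 1" and "m \<le> n"
  shows "hyperbolic_distortion (left_comp f n) z \<le> hyperbolic_distortion (left_comp f m) z"
proof -
  have "hyperbolic_distortion (left_comp f (Suc n)) z \<le> hyperbolic_distortion (left_comp f n) z" for n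
  proof -
    have L: "left_comp f n \<in> hol_self_maps" and F: "f (Suc n) \<in> hol_self_maps"
      using left_comp_hol_self_map[of f] f by auto
    have "hyperbolic_distortion (left_comp f (Suc n)) z =
        hyperbolic_distortion (f (Suc n)) (left_comp f n z) * hyperbolic_distortion (left_comp f n) z"
      by (simp add: hyperbolic_distortion_comp[OF L F z])
    also have "\<dots> \<le> 1 * hyperbolic_distortion (left_comp f n) z"
      using Schwarz_Pick[OF F hol_self_mapsD(2)[OF L z]] hyperbolic_distortion_nonneg[OF L z]
      by (rule mult_right_mono)
    finally show ?thesis by simp
  qed
  then show ?thesis
    by (rule lift_Suc_antimono_le[OF _ \<open>m \<le> n\<close>])
qed

text \<open>
  The normalization at the origin prevents the limit from being a unimodular constant, the only
  way in which a limit of self-maps can fail to be a self-map.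
\<close>

lemma normalized_sequence_has_limit:
  assumes g: "\<And>n. g n \<in> hol_self_maps" and g0: "\<And>n::nat. g n 0 = 0"
  obtains h r where "h \<in> hol_self_maps" and "strict_mono (r :: nat \<Rightarrow> nat)"
    and "\<And>z. z \<in> ball 0 1 \<Longrightarrow>
      (\<lambda>n. hyperbolic_distortion (g (r n)) z) \<longlonglongrightarrow> hyperbolic_distortion h z"
proof -
  have bounded: "\<exists>B. \<forall>h\<in>hol_self_maps. \<forall>z\<in>K. cmod (h z) \<le> B" if "K \<subseteq> ball 0 1" for K
    using that hol_self_mapsD(2) by (intro exI[of _ 1]) fastforce
  obtain h r where h: "h holomorphic_on ball 0 1" "strict_mono (r :: nat \<Rightarrow> nat)"
      "\<And>z. z \<in> ball 0 1 \<Longrightarrow> (\<lambda>n. g (r n) z) \<longlonglongrightarrow> h z"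
      "\<And>K. compact K \<Longrightarrow> K \<subseteq> ball 0 1 \<Longrightarrow> uniform_limit K (g \<circ> r) h sequentially"
    by (rule Montel[of "ball 0 1" hol_self_maps g]) (use g bounded hol_self_mapsD(1) in blast)+
  have h0: "h 0 = 0"
    using LIMSEQ_unique[OF h(3)[of 0]] g0 by simp
  have le1: "cmod (h z) \<le> 1" if "z \<in> ball 0 1" for z
    by (rule tendsto_upperbound[OF tendsto_norm[OF h(3)[OF that]]])
       (use hol_self_mapsD(2)[OF g that] in \<open>auto intro: always_eventually less_imp_le\<close>)
  have "cmod (h z) < 1" if z: "z \<in> ball 0 1" for z
  proof (rule ccontr)
    assume "\<not> cmod (h z) < 1"
    then have 1: "cmod (h z) = 1"
      using le1[OF z] by simp
    then have "h constant_on ball 0 1"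
      using maximum_modulus_principle[OF h(1) open_ball _ open_ball subset_refl z] le1 by auto
    then have "h z = h 0"
      using z unfolding constant_on_def by (metis centre_in_ball zero_less_one)
    then show False
      using 1 h0 by simp
  qed
  then have hs: "h \<in> hol_self_maps"
    using h(1) by (auto simp: hol_self_maps_def)
  have "(\<lambda>n. hyperbolic_distortion (g (r n)) z) \<longlonglongrightarrow> hyperbolic_distortion h z"
    if z: "z \<in> ball 0 1" for z
  proof -
    obtain e where e: "e > 0" "cball z e \<subseteq> ball 0 1"
      using z open_contains_cball[of "ball (0::complex) 1"] open_ball by blast
    have "uniform_limit (ball z e) (\<lambda>n. g (r n)) h sequentially"
      using uniform_limit_on_subset[OF h(4)[OF compact_cball e(2)] ball_subset_cball]
      by (simp add: o_def)
    then have "(\<lambda>n. deriv (g (r n)) z) \<longlonglongrightarrow> deriv h z"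
    proof (rule deriv_complex_uniform_limit)
      have "g (r n) holomorphic_on ball z e" for n
        using hol_self_mapsD(1)[OF g] e(2) ball_subset_cball
        by (meson holomorphic_on_subset order_trans)
      then show "\<forall>\<^sub>F n in sequentially. g (r n) holomorphic_on ball z e"
        by simp
    qed (use e in auto)
    moreover have "1 - (cmod (h z))\<^sup>2 \<noteq> 0"
      using one_minus_cmod_square_pos[OF hol_self_mapsD(2)[OF hs z]] by simp
    ultimately show ?thesis
      unfolding hyperbolic_distortion_eq[OF g z] hyperbolic_distortion_eq[OF hs z]
      by (intro tendsto_intros h(3)[OF z]) auto
  qed
  then show ?thesis
    using that hs h(2) by blast
qed

text \<open>
  The limit map is found along a subsequence of normalized maps, but the distortions of the
  whole sequence converge by monotonicity, and so must have the same limit.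
\<close>

lemma exists_distortion_limit:
  assumes f: "\<And>n. n \<ge> 1 \<Longrightarrow> f n \<in> hol_self_maps"
  shows "\<exists>h \<in> hol_self_maps. distortions_converge_to (left_comp f) h"
proof -
  define g where "g = (\<lambda>n. Moebius_function 0 (left_comp f n 0) \<circ> left_comp f n)"
  note L = left_comp_hol_self_map[of f, OF f]
  have aut: "Moebius_function 0 (left_comp f n 0) \<in> disc_automorphisms" for n
    using hol_self_mapsD(2)[OF L] by (intro Moebius_disc_automorphism) auto
  have g: "g n \<in> hol_self_maps" for n
    unfolding g_def using aut disc_automorphisms_subset L by (blast intro: hol_self_maps_comp)
  have g0: "g n 0 = 0" for n
    by (simp add: g_def Moebius_function_eq_zero)
  have eq: "hyperbolic_distortion (g n) z = hyperbolic_distortion (left_comp f n) z"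
    if "z \<in> ball 0 1" for n z
    unfolding g_def by (rule hyperbolic_distortion_automorphism_comp[OF aut L that])
  obtain h r where h: "h \<in> hol_self_maps" "strict_mono (r :: nat \<Rightarrow> nat)"
    "\<And>z. z \<in> ball 0 1 \<Longrightarrow>
      (\<lambda>n. hyperbolic_distortion (g (r n)) z) \<longlonglongrightarrow> hyperbolic_distortion h z"
    using normalized_sequence_has_limit[of g] g g0 by blast
  have lim: "(\<lambda>n. hyperbolic_distortion (left_comp f n) z) \<longlonglongrightarrow> hyperbolic_distortion h z"
    if z: "z \<in> ball 0 1" for z
  proof -
    let ?d = "\<lambda>n. hyperbolic_distortion (left_comp f n) z"
    have "decseq ?d"
      using left_comp_distortion_antimono[of f, OF f z] by (simp add: decseq_def)
    then obtain l where l: "?d \<longlonglongrightarrow> l"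
      using decseq_convergent[of ?d 0] hyperbolic_distortion_nonneg[OF L z] by blast
    have "(?d \<circ> r) \<longlonglongrightarrow> hyperbolic_distortion h z"
      using h(3)[OF z] by (simp add: o_def eq[OF z])
    then have "l = hyperbolic_distortion h z"
      using LIMSEQ_unique LIMSEQ_subseq_LIMSEQ[OF l h(2)] by blast
    then show ?thesis
      using l by simp
  qed
  have "uniform_limit K (\<lambda>n. hyperbolic_distortion (left_comp f n)) (hyperbolic_distortion h) sequentially"
    if K: "compact K" "K \<subseteq> ball 0 1" for K
    using K lim left_comp_distortion_antimono[of f, OF f]
    by (intro Dini_antimono continuous_on_subset[OF continuous_on_hyperbolic_distortion] L h(1)) auto
  then show ?thesis
    using h(1) unfolding distortions_converge_to_def by blast
qed

section \<open>Uniqueness: rigidity of maps with equal distortion\<close>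

text \<open>
  The first-order lower bound for \<open>|a + b| - |a|\<close>, multiplied by \<open>|a|\<close> to avoid division: the norm
  is convex and its derivative at \<open>a\<close> in direction \<open>b\<close> is \<open>Re (b * cnj a) / |a|\<close>.
\<close>

lemma cmod_add_minus_cmod_ge: "Re (b * cnj a) \<le> cmod a * (cmod (a + b) - cmod a)"
proof -
  have "Re (a * cnj a) + Re (b * cnj a) = Re ((a + b) * cnj a)"
    by (simp only: distrib_right plus_complex.sel)
  also have "\<dots> \<le> cmod ((a + b) * cnj a)"
    by (rule complex_Re_le_cmod)
  also have "\<dots> = cmod a * cmod (a + b)"
    by (simp add: norm_mult)
  finally have "Re (a * cnj a) + Re (b * cnj a) \<le> cmod a * cmod (a + b)" .
  moreover have "Re (a * cnj a) = (cmod a)\<^sup>2"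
    unfolding cmod_power2 by (simp add: power2_eq_square)
  ultimately show ?thesis
    by (simp add: right_diff_distrib power2_eq_square)
qed

text \<open>
  The comparison of leading terms at \<open>a\<close>. The factors \<open>1 - |z|\<^sup>2\<close> cancel in the equality of
  distortions, so there is no need to move \<open>a\<close> to the origin. The equality of the derivatives at \<open>a\<close>
  forces \<open>d'\<close> to vanish at \<open>a\<close>, say to order \<open>m > 0\<close>; then \<open>(z - a)\<^sup>m\<close> takes every
  argument near \<open>a\<close>, and a ray can be chosen along which \<open>d'\<close> is positively
  aligned with \<open>h'\<close> to leading order.
\<close>

lemma equal_distortion_rigid:
  assumes hk: "h \<in> hol_self_maps" "k \<in> hol_self_maps"
    and a: "a \<in> ball 0 1" "h a = 0" "k a = 0"
    and da: "deriv k a = deriv h a" "deriv h a \<noteq> 0"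
    and eq: "\<And>z. z \<in> ball 0 1 \<Longrightarrow> hyperbolic_distortion h z = hyperbolic_distortion k z"
    and z: "z \<in> ball 0 1"
  shows "h z = k z"
proof -
  note holh = hol_self_mapsD(1)[OF hk(1)]
  note holk = hol_self_mapsD(1)[OF hk(2)]
  define d where "d = (\<lambda>z. k z - h z)"
  have hold: "d holomorphic_on ball 0 1"
    unfolding d_def using holh holk by (intro holomorphic_intros)
  have d_deriv: "deriv d w = deriv k w - deriv h w" if "w \<in> ball 0 1" for w
    unfolding d_def using that holh holk
    by (intro deriv_diff holomorphic_on_imp_differentiable_at[OF _ open_ball]) auto
  have cross: "cmod (deriv h w) * (1 - (cmod (k w))\<^sup>2) = cmod (deriv k w) * (1 - (cmod (h w))\<^sup>2)"
    if w: "w \<in> ball 0 1" for w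
  proof -
    have "A * q = B * p" if "A * (s / p) = B * (s / q)" "0 < s" "0 < p" "0 < q"
      for A B p q s :: real
      using that by (simp add: frac_eq_eq)
    then show ?thesis
      using eq[OF w] one_minus_cmod_square_pos w hol_self_mapsD(2) hk
      unfolding hyperbolic_distortion_eq[OF hk(1) w] hyperbolic_distortion_eq[OF hk(2) w]
      by metis
  qed
  have key: "Re (deriv d w * cnj (deriv h w)) \<le> cmod (deriv h w) *
      (cmod (d w) * (cmod (h w) + cmod (k w)) * cmod (deriv k w) + (cmod (k w))\<^sup>2 * cmod (deriv d w))"
    if w: "w \<in> ball 0 1" "deriv h w \<noteq> 0" for w
  proof -
    have k': "deriv k w = deriv h w + deriv d w"
      using d_deriv[OF w(1)] by simp
    have 1: "(cmod (h w))\<^sup>2 - (cmod (k w))\<^sup>2 \<le> cmod (d w) * (cmod (h w) + cmod (k w))"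
    proof -
      have "(cmod (h w))\<^sup>2 - (cmod (k w))\<^sup>2 = (cmod (h w) - cmod (k w)) * (cmod (h w) + cmod (k w))"
        by (simp add: power2_eq_square algebra_simps)
      also have "\<dots> \<le> cmod (d w) * (cmod (h w) + cmod (k w))"
        unfolding d_def by (intro mult_right_mono) (simp_all add: norm_triangle_ineq2 norm_minus_commute)
      finally show ?thesis .
    qed
    have 2: "cmod (deriv k w) - cmod (deriv h w) \<le> cmod (deriv d w)"
      unfolding k' using norm_triangle_ineq[of "deriv h w" "deriv d w"] by simp
    have "cmod (deriv k w) - cmod (deriv h w) =
        ((cmod (h w))\<^sup>2 - (cmod (k w))\<^sup>2) * cmod (deriv k w) +
        (cmod (k w))\<^sup>2 * (cmod (deriv k w) - cmod (deriv h w))"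
      using cross[OF w(1)] by (simp add: algebra_simps)
    also have "\<dots> \<le> cmod (d w) * (cmod (h w) + cmod (k w)) * cmod (deriv k w) +
        (cmod (k w))\<^sup>2 * cmod (deriv d w)"
      using 1 2 by (intro add_mono mult_right_mono mult_left_mono) auto
    finally have "cmod (deriv h w) * (cmod (deriv h w + deriv d w) - cmod (deriv h w)) \<le>
        cmod (deriv h w) * (cmod (d w) * (cmod (h w) + cmod (k w)) * cmod (deriv k w) +
        (cmod (k w))\<^sup>2 * cmod (deriv d w))"
      unfolding k' by (rule mult_left_mono) simp
    then show ?thesis
      using cmod_add_minus_cmod_ge[of "deriv d w" "deriv h w"] by linarith
  qed
  \<comment> \<open>In \<open>key\<close>, if \<open>d'\<close> vanishes to order \<open>m\<close> at \<open>a\<close>, the right-hand side vanishes to a higher order.\<close>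
  have "d constant_on ball 0 1"
  proof (rule ccontr)
    assume nc: "\<not> d constant_on ball 0 1"
    have da0: "d a = 0"
      using a by (simp add: d_def)
    obtain G r n where n: "0 < n" and r: "0 < r" "ball a r \<subseteq> ball 0 1"
      and G: "G holomorphic_on ball a r" "\<And>w. w \<in> ball a r \<Longrightarrow> d w = (w - a) ^ n * G w"
        "\<And>w. w \<in> ball a r \<Longrightarrow> G w \<noteq> 0"
      by (rule holomorphic_factor_zero_nonconstant[OF hold open_ball connected_ball a(1) da0 nc], rule that)
    obtain m where m: "n = Suc m"
      using gr0_implies_Suc[OF n] ..
    define E where "E = (\<lambda>w. of_nat n * G w + (w - a) * deriv G w)"
    have d'E: "deriv d w = (w - a) ^ m * E w" if w: "w \<in> ball a r" for w
    proof -
      have "(G has_field_derivative deriv G w) (at w)"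
        using G(1) w by (auto intro: holomorphic_derivI)
      moreover have "((\<lambda>w. (w - a) ^ n) has_field_derivative of_nat n * (w - a) ^ m) (at w)"
        using DERIV_power_Suc[of "\<lambda>w. w - a" 1 w UNIV m] by (simp add: m DERIV_diff[of _ 1 _ _ _ 0, simplified])
      ultimately have "((\<lambda>w. (w - a) ^ n * G w) has_field_derivative
          of_nat n * (w - a) ^ m * G w + deriv G w * (w - a) ^ n) (at w)"
        by (rule DERIV_mult[rotated])
      then have "((\<lambda>w. (w - a) ^ n * G w) has_field_derivative (w - a) ^ m * E w) (at w)"
        by (simp add: m E_def algebra_simps)
      moreover have "\<forall>\<^sub>F w in nhds w. (w - a) ^ n * G w = d w"
        using eventually_nhds_in_open[OF open_ball w] by eventually_elim (simp add: G(2))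
      ultimately have "(d has_field_derivative (w - a) ^ m * E w) (at w)"
        by (subst (asm) DERIV_cong_ev) auto
      then show ?thesis
        by (rule DERIV_imp_deriv)
    qed
    have ar: "a \<in> ball a r"
      using r by simp
    have Ea: "E a \<noteq> 0"
      using G(3)[OF ar] n by (simp add: E_def)
    have m0: "m \<noteq> 0"
      using d'E[OF ar] d_deriv[OF a(1)] da Ea by auto
    define c where "c = E a * cnj (deriv h a)"
    have c0: "c \<noteq> 0"
      using Ea da by (simp add: c_def)
    \<comment> \<open>The direction \<open>u\<close> rotates the leading coefficient \<open>c\<close> of \<open>d' * cnj h'\<close> onto the positive axis.\<close>
    obtain u where u: "u ^ m = cnj c / cmod c"
      using exists_complex_root[OF m0] by metis
    have "cmod u ^ m = 1"
      using c0 by (simp add: norm_power[symmetric] u norm_divide)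
    then have nu: "cmod u = 1"
      using m0 power_eq_imp_eq_base[of "cmod u" m 1] by simp
    define p where "p = (\<lambda>t::real. a + of_real t * u)"
    have p: "(p \<longlongrightarrow> a) (at_right 0)"
      unfolding p_def by (auto intro!: tendsto_eq_intros)
    have comp: "((\<lambda>t. F (p t)) \<longlongrightarrow> F a) (at_right 0)" if "F holomorphic_on ball a r" for F
      by (rule isCont_tendsto_compose[OF _ p])
         (use that ar in \<open>meson holomorphic_on_imp_continuous_on continuous_on_interior interior_open open_ball continuous_on_eq_continuous_at\<close>)
    have "h holomorphic_on ball a r" "k holomorphic_on ball a r"
      using holh holk r(2) by (auto intro: holomorphic_on_subset)
    moreover from this have "deriv h holomorphic_on ball a r" "deriv k holomorphic_on ball a r"
      by (auto intro: holomorphic_deriv)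
    moreover have "E holomorphic_on ball a r"
      unfolding E_def using G(1) by (intro holomorphic_intros) auto
    ultimately have lims: "((\<lambda>t. h (p t)) \<longlongrightarrow> 0) (at_right 0)" "((\<lambda>t. k (p t)) \<longlongrightarrow> 0) (at_right 0)"
      "((\<lambda>t. deriv h (p t)) \<longlongrightarrow> deriv h a) (at_right 0)"
      "((\<lambda>t. deriv k (p t)) \<longlongrightarrow> deriv k a) (at_right 0)"
      "((\<lambda>t. E (p t)) \<longlongrightarrow> E a) (at_right 0)" "((\<lambda>t. G (p t)) \<longlongrightarrow> G a) (at_right 0)"
      using comp[of h] comp[of k] comp[of "deriv h"] comp[of "deriv k"] comp[of E] comp[of G] G(1) a
      by auto
    \<comment> \<open>The two sides of \<open>key\<close> at \<open>a + t * u\<close>, divided by \<open>t ^ m\<close>.\<close>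
    let ?L = "\<lambda>t. Re (u ^ m * (E (p t) * cnj (deriv h (p t))))"
    let ?R = "\<lambda>t. cmod (deriv h (p t)) * (t * cmod (G (p t)) * (cmod (h (p t)) + cmod (k (p t))) *
        cmod (deriv k (p t)) + (cmod (k (p t)))\<^sup>2 * cmod (E (p t)))"
    have "(?L \<longlongrightarrow> Re (u ^ m * (E a * cnj (deriv h a)))) (at_right 0)"
      by (intro tendsto_intros lims)
    moreover have "(?R \<longlongrightarrow> cmod (deriv h a) * (0 * cmod (G a) * (cmod 0 + cmod 0) * cmod (deriv k a) +
        (cmod 0)\<^sup>2 * cmod (E a))) (at_right 0)"
      by (intro tendsto_intros lims)
    moreover have "\<forall>\<^sub>F t in at_right 0. ?L t \<le> ?R t"
    proof -
      have "\<forall>\<^sub>F t in at_right 0. p t \<in> ball a r"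
        using topological_tendstoD[OF p open_ball ar] .
      moreover have "\<forall>\<^sub>F t in at_right 0. deriv h (p t) \<noteq> 0"
        using tendsto_imp_eventually_ne[OF lims(3) da(2)] .
      moreover have "\<forall>\<^sub>F t in at_right (0::real). 0 < t"
        by (rule eventually_at_right_less)
      ultimately show ?thesis
      proof eventually_elim
        case (elim t)
        then have pt: "p t \<in> ball 0 1"
          using r(2) by blast
        have pa: "p t - a = of_real t * u"
          by (simp add: p_def)
        have d1: "deriv d (p t) = of_real (t ^ m) * (u ^ m * E (p t))"
          using d'E elim(1) pa by (simp add: power_mult_distrib)
        have d2: "cmod (deriv d (p t)) = t ^ m * cmod (E (p t))"
          using elim(3) nu by (simp add: d1 norm_mult norm_power)
        have d3: "cmod (d (p t)) = t ^ m * (t * cmod (G (p t)))"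
          using elim(3) nu G(2)[OF elim(1)] by (simp add: pa norm_mult norm_power m)
        have "t ^ m * ?L t = Re (deriv d (p t) * cnj (deriv h (p t)))"
          unfolding d1 by (simp add: mult.assoc flip: of_real_power)
        also have "\<dots> \<le> t ^ m * ?R t"
          using key[OF pt elim(2)] unfolding d2 d3 by (simp add: algebra_simps)
        finally show ?case
          using elim(3) by simp
      qed
    qed
    ultimately have "Re (u ^ m * (E a * cnj (deriv h a))) \<le> 0"
      by (intro tendsto_le[OF trivial_limit_at_right_real]) auto
    moreover have "u ^ m * (E a * cnj (deriv h a)) = of_real (cmod c)"
    proof -
      have "cnj c * c = of_real (cmod c) * of_real (cmod c)"
        using complex_norm_square[of c] by (simp add: power2_eq_square mult.commute)
      then show ?thesis
        using c0 unfolding u c_def[symmetric] by simp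
    qed
    ultimately show False
      using c0 by simp
  qed
  then have "d z = d a"
    using a z unfolding constant_on_def by metis
  then show ?thesis
    using a by (simp add: d_def)
qed

text \<open>
  Left composition with automorphisms preserves distortion, so \<open>h\<close> and \<open>k\<close> can be brought to
  \<open>h a = k a = 0\<close>. At \<open>a\<close> the equality of distortions then says that the derivatives have equal
  modulus; a rotation \<open>c\<close> makes them equal, and \<open>equal_distortion_rigid\<close> applies.
\<close>

lemma equal_distortion_imp_automorphism:
  assumes h: "h \<in> hol_self_maps" and k: "k \<in> hol_self_maps"
    and eq: "\<And>z. z \<in> ball 0 1 \<Longrightarrow> hyperbolic_distortion h z = hyperbolic_distortion k z"
  shows "\<exists>\<phi> \<in> disc_automorphisms. \<forall>z \<in> ball 0 1. k z = \<phi> (h z)"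
proof -
  have "\<exists>a\<in>ball 0 1. \<exists>c. cmod c = 1 \<and> (\<forall>z\<in>ball 0 1.
      Moebius_function 0 (k a) (k z) = c * Moebius_function 0 (h a) (h z))"
  proof (cases "\<forall>z\<in>ball 0 1. deriv h z = 0")
    case True
    have const: "f z = f 0" if f: "f \<in> hol_self_maps" and z: "z \<in> ball 0 1"
      and 0: "\<forall>z\<in>ball 0 1. deriv f z = 0" for f z
    proof -
      have "\<exists>c. \<forall>z\<in>ball 0 1. f z = c"
        using hol_self_mapsD(1)[OF f] 0
        by (intro has_field_derivative_zero_constant) (auto simp: has_field_derivative_at_within dest!: holomorphic_derivI[OF _ open_ball])
      then show ?thesis
        using z by (metis centre_in_ball zero_less_one)
    qed
    have "\<forall>z\<in>ball 0 1. deriv k z = 0"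
      using True eq hyperbolic_distortion_eq_0_iff h k by metis
    then have "Moebius_function 0 (k 0) (k z) = 1 * Moebius_function 0 (h 0) (h z)"
      if "z \<in> ball 0 1" for z
      using const[OF h that True] const[OF k that] by (metis Moebius_function_eq_zero mult_1)
    then show ?thesis
      by (intro bexI[of _ 0] exI[of _ 1]) auto
  next
    case False
    then obtain a where a: "a \<in> ball 0 1" "deriv h a \<noteq> 0"
      by blast
    define A where "A = Moebius_function 0 (h a)"
    define B where "B = Moebius_function 0 (k a)"
    have AB: "A \<in> disc_automorphisms" "B \<in> disc_automorphisms"
      unfolding A_def B_def using hol_self_mapsD(2) h k a Moebius_disc_automorphism by auto
    have Ah: "A \<circ> h \<in> hol_self_maps" and Bk: "B \<circ> k \<in> hol_self_maps"
      using AB disc_automorphisms_subset h k hol_self_maps_comp by blast+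
    have Aa: "(A \<circ> h) a = 0" and Ba: "(B \<circ> k) a = 0"
      by (simp_all add: A_def B_def Moebius_function_eq_zero)
    have eq': "hyperbolic_distortion (A \<circ> h) z = hyperbolic_distortion (B \<circ> k) z"
      if "z \<in> ball 0 1" for z
      using that AB h k eq by (simp only: hyperbolic_distortion_automorphism_comp)
    have nz: "deriv (A \<circ> h) a \<noteq> 0"
      using a hyperbolic_distortion_eq_0_iff[OF Ah a(1)] hyperbolic_distortion_eq_0_iff[OF h a(1)]
        hyperbolic_distortion_automorphism_comp[OF AB(1) h a(1)] by simp
    have norm_eq: "cmod (deriv (A \<circ> h) a) = cmod (deriv (B \<circ> k) a)"
      using eq'[OF a(1)] one_minus_cmod_square_pos[OF a(1)] Aa Ba
      unfolding hyperbolic_distortion_eq[OF Ah a(1)] hyperbolic_distortion_eq[OF Bk a(1)] by simp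
    define c where "c = deriv (B \<circ> k) a / deriv (A \<circ> h) a"
    have c: "cmod c = 1"
      using nz by (simp add: c_def norm_divide norm_eq[symmetric])
    define R where "R = (\<lambda>z. c * z)"
    have R: "R \<in> disc_automorphisms"
      unfolding R_def by (rule rotation_disc_automorphism[OF c])
    have RAh: "R \<circ> (A \<circ> h) \<in> hol_self_maps"
      using R disc_automorphisms_subset Ah hol_self_maps_comp by blast
    have "(A \<circ> h) field_differentiable at a"
      using hol_self_mapsD(1)[OF Ah] a(1) holomorphic_on_imp_differentiable_at open_ball by blast
    then have "deriv (R \<circ> (A \<circ> h)) a = c * deriv (A \<circ> h) a"
      unfolding R_def o_def by (rule deriv_cmult)
    then have der: "deriv (B \<circ> k) a = deriv (R \<circ> (A \<circ> h)) a" "deriv (R \<circ> (A \<circ> h)) a \<noteq> 0"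
      using nz c by (auto simp: c_def)
    have "(R \<circ> (A \<circ> h)) z = (B \<circ> k) z" if "z \<in> ball 0 1" for z
    proof (rule equal_distortion_rigid[OF RAh Bk a(1) _ Ba der _ that])
      show "(R \<circ> (A \<circ> h)) a = 0"
        using Aa by (simp add: R_def)
    qed (simp only: hyperbolic_distortion_automorphism_comp[OF R Ah] eq')
    then show ?thesis
      using a(1) c unfolding A_def B_def R_def o_def
      by (intro bexI[of _ a] exI[of _ c] conjI ballI) auto
  qed
  then obtain a c where a: "a \<in> ball 0 1" and c: "cmod c = 1"
    and rel: "\<And>z. z \<in> ball 0 1 \<Longrightarrow>
      Moebius_function 0 (k a) (k z) = c * Moebius_function 0 (h a) (h z)"
    by blast
  have aut: "Moebius_function 0 (h a) \<in> disc_automorphisms" "Moebius_function 0 (k a) \<in> disc_automorphisms"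
    using hol_self_mapsD(2) h k a Moebius_disc_automorphism by auto
  obtain \<psi> where \<psi>: "\<psi> \<in> disc_automorphisms"
    "\<And>z. z \<in> ball 0 1 \<Longrightarrow> \<psi> (Moebius_function 0 (k a) z) = z"
    using disc_automorphisms_inverse[OF aut(2)] by blast
  let ?\<phi> = "\<psi> \<circ> ((\<lambda>z. c * z) \<circ> Moebius_function 0 (h a))"
  have "?\<phi> \<in> disc_automorphisms"
    using aut(1) \<psi>(1) c by (intro disc_automorphisms_comp rotation_disc_automorphism)
  moreover have "k z = ?\<phi> (h z)" if "z \<in> ball 0 1" for z
    using \<psi>(2)[OF hol_self_mapsD(2)[OF k that]] rel[OF that] by simp
  ultimately show ?thesis
    by blast
qed

theorem corollaryB:
  fixes f :: "nat \<Rightarrow> complex \<Rightarrow> complex"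
  assumes "\<And>n. n \<ge> 1 \<Longrightarrow> f n \<in> hol_self_maps"
  shows "(\<exists>h \<in> hol_self_maps. distortions_converge_to (left_comp f) h) \<and>
         (\<forall>h \<in> hol_self_maps. \<forall>k \<in> hol_self_maps.
            distortions_converge_to (left_comp f) h \<and> distortions_converge_to (left_comp f) k \<longrightarrow>
            (\<exists>\<phi> \<in> disc_automorphisms. \<forall>z \<in> ball 0 1. k z = \<phi> (h z)))"
proof (intro conjI ballI impI)
  show "\<exists>h \<in> hol_self_maps. distortions_converge_to (left_comp f) h"
    by (rule exists_distortion_limit[OF assms])
next
  fix h k
  assume hk: "h \<in> hol_self_maps" "k \<in> hol_self_maps"
    and conv: "distortions_converge_to (left_comp f) h \<and> distortions_converge_to (left_comp f) k"
  have lim: "(\<lambda>n. hyperbolic_distortion (left_comp f n) z) \<longlonglongrightarrow> hyperbolic_distortion g z"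
    if "distortions_converge_to (left_comp f) g" "z \<in> ball 0 1" for g z
    using that unfolding distortions_converge_to_def by (elim allE[of _ "{z}"]) auto
  have "hyperbolic_distortion h z = hyperbolic_distortion k z" if "z \<in> ball 0 1" for z
    using lim conv that LIMSEQ_unique by blast
  then show "\<exists>\<phi> \<in> disc_automorphisms. \<forall>z \<in> ball 0 1. k z = \<phi> (h z)"
    by (rule equal_distortion_imp_automorphism[OF hk])
qed

end
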